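(* Let $A$ be a ring with $1$, $\sigma$ a ring endomorphism of $A$, $\delta$ a $\sigma$-derivation of $A$, and $R=A[t;\sigma,\delta]$. Let $f,g,h,h'\in R$ be monic polynomials such that $f=gh=h'g$, with $\deg f=n>0$ and $\deg h<n$. Let $C\subseteq A^n$ denote the code corresponding to the cyclic module $Rg/Rf$, and let $\underline{h}=(h_0,\dots,h_{n-1})\in A^n$ where $h(t)=\sum_{i=0}^{n-1}h_it^i$. Then for $(c_0,\dots,c_{n-1})\in A^n$ the following statements are equivalent: (i) $(c_0,\dots,c_{n-1})\in C$; (ii) $\left(\sum_{i=0}^{n-1}c_it^i\right)h(t)\in Rf$; (iii) $\sum_{i=0}^{n-1}c_iT_f^i(\underline{h})=\underline{0}$; (iv) $\sum_{j=0}^{n-1}\left(\sum_{i=j}^{n-1}c_if_j^i(\underline{h})\right)N_j(C_f)=\underline{0}$.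
   Context: A $\sigma$-derivation of $A$ is an additive map $\delta:A\to A$ with $\delta(ab)=\sigma(a)\delta(b)+\delta(a)b$ for all $a,b\in A$. Ring endomorphisms are unital. The skew polynomial (Ore) ring $R=A[t;\sigma,\delta]$ consists of the polynomials $\sum a_it^i$ with coefficients $a_i\in A$ written on the left, with usual addition and with multiplication determined by $ta=\sigma(a)t+\delta(a)$ for $a\in A$. Monic means leading coefficient $1$. For $f(t)=\sum_{i=0}^{n}a_it^i$ monic of degree $n$, the companion matrix $C_f\in M_n(A)$ has rows $e_2,e_3,\dots,e_n$ (standard basis row vectors) and last row $(-a_0,-a_1,\dots,-a_{n-1})$. The map $T_f:A^n\to A^n$ is $T_f(x_1,\dots,x_n)=(\sigma(x_1),\dots,\sigma(x_n))C_f+(\delta(x_1),\dots,\delta(x_n))$; elements of $A^n$ are row vectors and $A^n$ is a left $A$-module. Since $f$ is monic of degree $n$, every class in the left $R$-module $R/Rf$ has a unique representative $\sum_{i=0}^{n-1}c_it^i$. For a monic $g$ with $f\in Rg$, the code corresponding to $Rg/Rf$ is the set $C\subseteq A^n$ of coordinate vectors $(c_0,\dots,c_{n-1})$, in the basis $1,t,\dots,t^{n-1}$, of the elements of $Rg/Rf\subseteq R/Rf$. For $0\le j\le i$, $f_j^i$ denotes the sum of all words (compositions) in $\sigma$ and $\delta$ having $j$ letters $\sigma$ and $i-j$ letters $\delta$ (not to be confused with the polynomial $f$); it is an additive map $A\to A$, extended componentwise to $A^n$. The maps $\sigma,\delta$ are extended entrywise to $M_n(A)$, and for $M\in M_n(A)$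 the matrices $N_j(M)$ are defined by $N_0(M)=I_n$ and $N_{j+1}(M)=\sigma(N_j(M))M+\delta(N_j(M))$ (equivalently $N_j(M)$ is the remainder of $t^j$ on right division by $t-M$ in $M_n(A)[t;\sigma,\delta]$). *)

theory Defs
  imports
    "Jordan_Normal_Form.Matrix"
    "HOL-Computational_Algebra.Polynomial"
begin

definition skew_derivation :: "('a::ring_1 \<Rightarrow> 'a) \<Rightarrow> ('a \<Rightarrow> 'a) \<Rightarrow> bool" where
  "skew_derivation \<sigma> \<delta> \<longleftrightarrow>
     (\<forall>a b. \<delta> (a + b) = \<delta> a + \<delta> b) \<and>
     (\<forall>a b. \<delta> (a * b) = \<sigma> a * \<delta> b + \<delta> a * b)"

subsection \<open>The Ore ring\<close>

text \<open>
  The additive group of \<open>A[t;\<sigma>,\<delta>]\<close> is the library type \<open>'a poly\<close>, with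
  \<open>coeff p i\<close> the left coefficient of \<open>t\<^sup>i\<close>. The library product on \<open>'a poly\<close> (which is only
  available over commutative rings) is never used; the product is \<open>skew_mult\<close>.
\<close>

definition left_scale :: "'a::ring_1 \<Rightarrow> 'a poly \<Rightarrow> 'a poly" where
  "left_scale a p = map_poly ((*) a) p"

text \<open>Left multiplication by \<open>t\<close>: \<open>t (\<Sum>i. b\<^sub>i t\<^sup>i) = \<Sum>i. \<sigma>(b\<^sub>i) t\<^sup>i\<^sup>+\<^sup>1 + \<Sum>i. \<delta>(b\<^sub>i) t\<^sup>i\<close>.\<close>

definition t_mult :: "('a::ring_1 \<Rightarrow> 'a) \<Rightarrow> ('a \<Rightarrow> 'a) \<Rightarrow> 'a poly \<Rightarrow> 'a poly" where
  "t_mult \<sigma> \<delta> q = pCons 0 (map_poly \<sigma> q) + map_poly \<delta> q"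

definition skew_mult :: "('a::ring_1 \<Rightarrow> 'a) \<Rightarrow> ('a \<Rightarrow> 'a) \<Rightarrow> 'a poly \<Rightarrow> 'a poly \<Rightarrow> 'a poly" where
  "skew_mult \<sigma> \<delta> p q = (\<Sum>i\<le>degree p. left_scale (coeff p i) ((t_mult \<sigma> \<delta> ^^ i) q))"

lemma coeff_left_scale [simp]: "coeff (left_scale a p) i = a * coeff p i"
  by (simp add: left_scale_def coeff_map_poly)

context
  fixes \<sigma> \<delta> :: "'a::ring_1 \<Rightarrow> 'a"
  assumes \<sigma>: "Ring_Hom.ring_hom \<sigma>" and \<delta>: "skew_derivation \<sigma> \<delta>"
begin

private lemma \<sigma>_simps: "\<sigma> 0 = 0" "\<sigma> 1 = 1" "\<sigma> (a + b) = \<sigma> a + \<sigma> b" "\<sigma> (a * b) = \<sigma> a * \<sigma> b"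
proof -
  interpret Ring_Hom.ring_hom \<sigma> by (rule \<sigma>)
  show "\<sigma> 0 = 0" "\<sigma> 1 = 1" "\<sigma> (a + b) = \<sigma> a + \<sigma> b" "\<sigma> (a * b) = \<sigma> a * \<sigma> b"
    by (simp_all add: hom_distribs)
qed

private lemma \<delta>_simps: "\<delta> 0 = 0" "\<delta> (a + b) = \<delta> a + \<delta> b" "\<delta> (a * b) = \<sigma> a * \<delta> b + \<delta> a * b"
proof -
  show add: "\<delta> (a + b) = \<delta> a + \<delta> b" for a b using \<delta> by (simp add: skew_derivation_def)
  from add[of 0 0] show "\<delta> 0 = 0" by simp
  show "\<delta> (a * b) = \<sigma> a * \<delta> b + \<delta> a * b" using \<delta> by (simp add: skew_derivation_def)
qed

private lemma \<delta>_1: "\<delta> 1 = 0"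
  using \<delta>_simps(3)[of 1 1] by (simp add: \<sigma>_simps)

private abbreviation (input) T where "T \<equiv> t_mult \<sigma> \<delta>"
private abbreviation (input) mul (infixl "\<star>" 70) where "mul \<equiv> skew_mult \<sigma> \<delta>"

private lemma coeff_T:
  "coeff (T q) i = (case i of 0 \<Rightarrow> 0 | Suc k \<Rightarrow> \<sigma> (coeff q k)) + \<delta> (coeff q i)"
  by (simp add: t_mult_def coeff_pCons coeff_map_poly \<sigma>_simps \<delta>_simps split: nat.split)

private lemma T_0: "T 0 = 0"
  by (simp add: t_mult_def)

private lemma T_add: "T (p + q) = T p + T q"
  by (rule poly_eqI) (simp add: coeff_T \<sigma>_simps \<delta>_simps add_ac split: nat.split)

private lemma T_sum: "T (sum f I) = (\<Sum>i\<in>I. T (f i))"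
  by (induction I rule: infinite_finite_induct) (simp_all add: T_0 T_add)

private lemma T_pow_add: "(T ^^ n) (p + q) = (T ^^ n) p + (T ^^ n) q"
  by (induction n) (simp_all add: T_add)

private lemma T_scale: "T (left_scale a q) = left_scale (\<sigma> a) (T q) + left_scale (\<delta> a) q"
  by (rule poly_eqI) (simp add: coeff_T \<sigma>_simps \<delta>_simps algebra_simps split: nat.split)

private lemma scale_simps:
  "left_scale 0 p = 0" "left_scale a 0 = 0" "left_scale 1 p = p"
  "left_scale (a + b) p = left_scale a p + left_scale b p"
  "left_scale a (p + q) = left_scale a p + left_scale a q"
  "left_scale a (left_scale b p) = left_scale (a * b) p"
  by (rule poly_eqI; simp add: algebra_simps)+

private lemma scale_sum: "left_scale a (sum f I) = (\<Sum>i\<in>I. left_scale a (f i))"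
  by (induction I rule: infinite_finite_induct) (simp_all add: scale_simps)

private lemma mul_upto:
  assumes "degree p \<le> N"
  shows "p \<star> q = (\<Sum>i\<le>N. left_scale (coeff p i) ((T ^^ i) q))"
  unfolding skew_mult_def
  using assms by (intro sum.mono_neutral_left) (auto simp: coeff_eq_0 scale_simps not_le)

private lemma mul_add_left: "(p + q) \<star> r = p \<star> r + q \<star> r"
  using mul_upto[of p "max (degree p) (degree q)" r] mul_upto[of q "max (degree p) (degree q)" r]
    mul_upto[of "p + q" "max (degree p) (degree q)" r]
  by (simp add: degree_add_le_max scale_simps sum.distrib)

private lemma mul_add_right: "p \<star> (q + r) = p \<star> q + p \<star> r"
  by (simp add: skew_mult_def T_pow_add scale_simps sum.distrib)

private lemma mul_0_left: "0 \<star> q = 0"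
  by (simp add: skew_mult_def scale_simps)

private lemma mul_sum_left: "sum f I \<star> q = (\<Sum>i\<in>I. f i \<star> q)"
  by (induction I rule: infinite_finite_induct) (simp_all add: mul_0_left mul_add_left)

private lemma mul_scale: "left_scale a p \<star> q = left_scale a (p \<star> q)"
proof -
  have "degree (left_scale a p) \<le> degree p"
    by (rule degree_le) (simp add: coeff_eq_0)
  then show ?thesis
    by (simp add: mul_upto[of _ "degree p"] scale_simps scale_sum)
qed

private lemma mul_T: "T p \<star> q = T (p \<star> q)"
proof -
  have "degree (T p) \<le> Suc (degree p)"
    by (rule degree_le) (auto simp: coeff_T coeff_eq_0 \<sigma>_simps \<delta>_simps split: nat.split)
  then have "T p \<star> q = (\<Sum>i\<le>Suc (degree p). left_scale (coeff (T p) i) ((T ^^ i) q))"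
    by (rule mul_upto)
  also have "\<dots> = (\<Sum>i\<le>Suc (degree p). left_scale (case i of 0 \<Rightarrow> 0 | Suc k \<Rightarrow> \<sigma> (coeff p k)) ((T ^^ i) q))
     + (\<Sum>i\<le>Suc (degree p). left_scale (\<delta> (coeff p i)) ((T ^^ i) q))"
    by (simp only: coeff_T scale_simps sum.distrib)
  also have "\<dots> = (\<Sum>i\<le>degree p. left_scale (\<sigma> (coeff p i)) (T ((T ^^ i) q)))
     + (\<Sum>i\<le>degree p. left_scale (\<delta> (coeff p i)) ((T ^^ i) q))"
  proof (rule arg_cong2[where f = "(+)"], goal_cases)
    case 1
    show ?case
      by (simp add: sum.atMost_Suc_shift scale_simps del: sum.atMost_Suc)
  qed (simp add: scale_simps coeff_eq_0 \<delta>_simps)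
  also have "\<dots> = T (p \<star> q)"
    by (simp add: skew_mult_def T_sum T_scale sum.distrib)
  finally show ?thesis .
qed

private lemma mul_T_pow: "(T ^^ n) p \<star> q = (T ^^ n) (p \<star> q)"
  by (induction n) (simp_all add: mul_T)

lemma skew_mult_ring:
  "class.ring_1 [:1:] (skew_mult \<sigma> \<delta>) (+) (0 :: 'a poly) (-) uminus"
proof unfold_locales
  fix p q r :: "'a poly"
  show "p \<star> q \<star> r = p \<star> (q \<star> r)"
    by (simp add: skew_mult_def[of _ _ p] mul_sum_left mul_scale mul_T_pow)
  show "[:1:] \<star> p = p"
    by (simp add: skew_mult_def scale_simps)
  have T1: "(T ^^ i) [:1:] = monom 1 i" for i
  proof (induction i)
    case (Suc i)
    then show ?case
      by (auto intro!: poly_eqI simp: coeff_T \<sigma>_simps \<delta>_simps \<delta>_1 split: nat.split)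
  qed (simp add: monom_0)
  have scale_monom: "left_scale a (monom 1 i) = monom a i" for a i
    by (rule poly_eqI) simp
  show "p \<star> [:1:] = p"
    by (simp add: skew_mult_def T1 scale_monom poly_as_sum_of_monoms)
  show "(p + q) \<star> r = p \<star> r + q \<star> r" "p \<star> (q + r) = p \<star> q + p \<star> r"
    by (rule mul_add_left mul_add_right)+
  show "0 \<noteq> [:1 :: 'a:]"
    by simp
qed

lemma skew_mult_monom_const:
  "skew_mult \<sigma> \<delta> (monom 1 1) [:a:] = monom (\<sigma> a) 1 + [:\<delta> a:]"
  "skew_mult \<sigma> \<delta> [:a:] p = left_scale a p"
  by (simp_all add: skew_mult_def degree_monom_eq scale_simps t_mult_def map_poly_pCons
      \<sigma>_simps \<delta>_simps monom_altdef) (simp_all add: monom_Suc monom_0)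

end

subsection \<open>The module \<open>R/Rf\<close> and its codes\<close>

definition left_ideal :: "('a::ring_1 \<Rightarrow> 'a) \<Rightarrow> ('a \<Rightarrow> 'a) \<Rightarrow> 'a poly \<Rightarrow> 'a poly set" where
  "left_ideal \<sigma> \<delta> f = range (\<lambda>r. skew_mult \<sigma> \<delta> r f)"

definition cong_rel :: "('a::ring_1 \<Rightarrow> 'a) \<Rightarrow> ('a \<Rightarrow> 'a) \<Rightarrow> 'a poly \<Rightarrow> ('a poly \<times> 'a poly) set" where
  "cong_rel \<sigma> \<delta> f = {(p, q). p - q \<in> left_ideal \<sigma> \<delta> f}"

text \<open>The submodule \<open>Rg/Rf\<close> of \<open>R/Rf\<close>, as a set of residue classes modulo \<open>Rf\<close>.\<close>

definition quotient_submodule ::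
    "('a::ring_1 \<Rightarrow> 'a) \<Rightarrow> ('a \<Rightarrow> 'a) \<Rightarrow> 'a poly \<Rightarrow> 'a poly \<Rightarrow> 'a poly set set" where
  "quotient_submodule \<sigma> \<delta> g f = left_ideal \<sigma> \<delta> g // cong_rel \<sigma> \<delta> f"

definition poly_of_coords :: "'a::ring_1 vec \<Rightarrow> 'a poly" where
  "poly_of_coords c = (\<Sum>i<dim_vec c. monom (c $ i) i)"

definition code :: "('a::ring_1 \<Rightarrow> 'a) \<Rightarrow> ('a \<Rightarrow> 'a) \<Rightarrow> 'a poly \<Rightarrow> 'a poly \<Rightarrow> 'a vec set" where
  "code \<sigma> \<delta> g f =
     {c \<in> carrier_vec (degree f).
        cong_rel \<sigma> \<delta> f `` {poly_of_coords c} \<in> quotient_submodule \<sigma> \<delta> g f}"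

subsection \<open>The companion matrix and the maps \<open>T\<^sub>f\<close>, \<open>f\<^sub>j\<^sup>i\<close>, \<open>N\<^sub>j\<close>\<close>

definition row_mult_mat :: "'a::ring_1 vec \<Rightarrow> 'a mat \<Rightarrow> 'a vec" (infixl "\<^sub>v*" 70) where
  "v \<^sub>v* M = vec (dim_col M) (\<lambda>j. v \<bullet> col M j)"

definition companion_mat :: "'a::ring_1 poly \<Rightarrow> 'a mat" where
  "companion_mat f = mat (degree f) (degree f)
     (\<lambda>(i, j). if i + 1 = degree f then - coeff f j else if j = i + 1 then 1 else 0)"

definition T_map :: "('a::ring_1 \<Rightarrow> 'a) \<Rightarrow> ('a \<Rightarrow> 'a) \<Rightarrow> 'a poly \<Rightarrow> 'a vec \<Rightarrow> 'a vec" where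
  "T_map \<sigma> \<delta> f x = map_vec \<sigma> x \<^sub>v* companion_mat f + map_vec \<delta> x"

text \<open>
  A word in \<open>\<sigma>, \<delta>\<close> is a list of booleans, \<open>True\<close> standing for \<open>\<sigma>\<close> and \<open>False\<close> for \<open>\<delta>\<close>; the sum is
  over words, so distinct words that happen to give the same map are counted separately.
\<close>

definition word_map :: "('a \<Rightarrow> 'a) \<Rightarrow> ('a \<Rightarrow> 'a) \<Rightarrow> bool list \<Rightarrow> 'a \<Rightarrow> 'a" where
  "word_map \<sigma> \<delta> w = foldr (\<lambda>b. if b then \<sigma> else \<delta>) w"

definition word_sum :: "('a::ring_1 \<Rightarrow> 'a) \<Rightarrow> ('a \<Rightarrow> 'a) \<Rightarrow> nat \<Rightarrow> nat \<Rightarrow> 'a \<Rightarrow> 'a" where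
  "word_sum \<sigma> \<delta> i j a =
     (\<Sum>w \<in> {w. length w = i \<and> count_list w True = j}. word_map \<sigma> \<delta> w a)"

fun N_mat :: "('a::ring_1 \<Rightarrow> 'a) \<Rightarrow> ('a \<Rightarrow> 'a) \<Rightarrow> 'a mat \<Rightarrow> nat \<Rightarrow> 'a mat" where
  "N_mat \<sigma> \<delta> M 0 = 1\<^sub>m (dim_row M)"
| "N_mat \<sigma> \<delta> M (Suc j) = map_mat \<sigma> (N_mat \<sigma> \<delta> M j) * M + map_mat \<delta> (N_mat \<sigma> \<delta> M j)"

end

theory Submission
  imports Defs
begin

text \<open>
  Because \<open>h\<close> and \<open>f\<close> are monic, right multiplication by them raises degrees exactly. Hence \<open>h\<close> is
  right cancellable, so \<open>p h \<in> R f = R g h\<close> forces \<open>p \<in> R g\<close>, and a polynomial of degree below \<open>n\<close>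
  lies in \<open>R f\<close> only if it vanishes. In coordinates modulo \<open>R f\<close>, the map \<open>T\<^sub>f\<close> is left multiplication
  by \<open>t\<close>, so \<open>\<Sum> c\<^sub>i T\<^sub>f\<^sup>i(h)\<close> is the coordinate vector of \<open>(\<Sum> c\<^sub>i t\<^sup>i) h\<close>. Finally, iterating the
  product rule gives the expansion \<open>T\<^sub>f\<^sup>i(x) = \<Sum>\<^sub>j f\<^sub>j\<^sup>i(x) N\<^sub>j(C\<^sub>f)\<close>.
\<close>

section \<open>The Ore ring: ring laws and left multiplication by t\<close>

locale skew_poly =
  fixes \<sigma> \<delta> :: "'a::ring_1 \<Rightarrow> 'a"
  assumes ring_hom: "Ring_Hom.ring_hom \<sigma>" and skew_derivation: "skew_derivation \<sigma> \<delta>"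
begin

sublocale \<sigma>: Ring_Hom.ring_hom \<sigma>
  by (rule ring_hom)

abbreviation mul (infixl "\<star>" 70) where "mul \<equiv> skew_mult \<sigma> \<delta>"
abbreviation T where "T \<equiv> t_mult \<sigma> \<delta>"

lemma \<delta>_add: "\<delta> (a + b) = \<delta> a + \<delta> b"
  using skew_derivation by (simp add: skew_derivation_def)

lemma \<delta>_mult: "\<delta> (a * b) = \<sigma> a * \<delta> b + \<delta> a * b"
  using skew_derivation by (simp add: skew_derivation_def)

lemma \<delta>_0 [simp]: "\<delta> 0 = 0"
  using \<delta>_add[of 0 0] by simp

lemma \<delta>_sum: "\<delta> (sum u I) = (\<Sum>i\<in>I. \<delta> (u i))"
  by (induction I rule: infinite_finite_induct) (simp_all add: \<delta>_add)

lemma \<sigma>_sum: "\<sigma> (sum u I) = (\<Sum>i\<in>I. \<sigma> (u i))"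
  by (induction I rule: infinite_finite_induct) (simp_all add: \<sigma>.hom_add)

lemma mul_assoc: "p \<star> q \<star> r = p \<star> (q \<star> r)"
  and mul_add_left: "(p + q) \<star> r = p \<star> r + q \<star> r"
  and mul_add_right: "p \<star> (q + r) = p \<star> q + p \<star> r"
  and mul_diff_left: "(p - q) \<star> r = p \<star> r - q \<star> r"
  and mul_zero_left: "0 \<star> r = 0"
proof -
  interpret R: ring_1 "[:1:]" "skew_mult \<sigma> \<delta>" "(+)" "0 :: 'a poly" "(-)" uminus
    using skew_mult_ring[OF ring_hom skew_derivation] .
  show "p \<star> q \<star> r = p \<star> (q \<star> r)" by (rule R.mult.assoc)
  show "(p + q) \<star> r = p \<star> r + q \<star> r" by (rule R.distrib_right)
  show "p \<star> (q + r) = p \<star> q + p \<star> r" by (rule R.distrib_left)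
  show "(p - q) \<star> r = p \<star> r - q \<star> r" by (rule R.left_diff_distrib)
  show "0 \<star> r = 0" by (rule R.mult_zero_left)
qed

lemma mul_sum_left: "sum u I \<star> r = (\<Sum>i\<in>I. u i \<star> r)"
  by (induction I rule: infinite_finite_induct) (simp_all add: mul_zero_left mul_add_left)

lemma coeff_T:
  "coeff (T q) i = (case i of 0 \<Rightarrow> 0 | Suc k \<Rightarrow> \<sigma> (coeff q k)) + \<delta> (coeff q i)"
  by (simp add: t_mult_def coeff_pCons coeff_map_poly split: nat.split)

lemma left_scale_0 [simp]: "left_scale 0 p = 0"
  by (rule poly_eqI) simp

lemma left_scale_1 [simp]: "left_scale 1 p = p"
  by (rule poly_eqI) simp

lemma T_conv_mul: "T p = monom 1 1 \<star> p"
  by (simp add: skew_mult_def degree_monom_eq)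

lemma const_mul: "[:a:] \<star> p = left_scale a p"
  by (rule skew_mult_monom_const(2)[OF ring_hom skew_derivation])

lemma monom_mul: "monom a i \<star> q = left_scale a ((T ^^ i) q)"
\<comment> \<open>If \<open>a = 0\<close>, the monomial has degree 0 whatever \<open>i\<close> is,
  so the sum defining the product has another range.\<close>
proof (cases "a = 0")
  case False
  then have "monom a i \<star> q = (\<Sum>k\<le>i. left_scale (if i = k then a else 0) ((T ^^ k) q))"
    by (simp add: skew_mult_def degree_monom_eq)
  also have "\<dots> = (\<Sum>k\<le>i. if i = k then left_scale a ((T ^^ k) q) else 0)"
    by (intro sum.cong) simp_all
  finally show ?thesis by simp
qed (simp add: mul_zero_left)

section \<open>Degrees of products with a monic right factor\<close>

text \<open>Each application of \<open>T\<close> moves the top coefficient up one place through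
  \<sigma>, which fixes 1. Vanishing above the top is part of the induction because it kills the
  \<delta> term there.\<close>

lemma coeff_T_pow_ge:
  assumes "lead_coeff q = 1"
  shows "coeff ((T ^^ i) q) (i + degree q) = 1 \<and> (\<forall>k > i + degree q. coeff ((T ^^ i) q) k = 0)"
proof (induction i)
  case 0
  then show ?case using assms by (simp add: coeff_eq_0)
next
  case (Suc i)
  then show ?case by (auto simp: coeff_T \<sigma>.hom_one split: nat.split)
qed

text \<open>Only the summand for \<open>i = degree p\<close> reaches this degree, and there it
  contributes \<open>lead_coeff p\<close> times 1. The ring A may have zero divisors and \<sigma> a
  kernel; monicity of the right factor keeps the product from losing its top term.\<close>

lemma coeff_mul_monic_top:
  assumes "lead_coeff q = 1"
  shows "coeff (p \<star> q) (degree p + degree q) = lead_coeff p"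
proof -
  have "coeff (p \<star> q) (degree p + degree q)
      = (\<Sum>i\<le>degree p. coeff p i * coeff ((T ^^ i) q) (degree p + degree q))"
    by (simp add: skew_mult_def coeff_sum)
  also have "\<dots> = (\<Sum>i\<in>{degree p}. coeff p i * coeff ((T ^^ i) q) (degree p + degree q))"
    by (rule sum.mono_neutral_right) (auto simp: coeff_T_pow_ge[OF assms])
  finally show ?thesis by (simp add: coeff_T_pow_ge[OF assms])
qed

lemma mul_monic_eq_0:
  assumes "lead_coeff q = 1" and "p \<star> q = 0"
  shows "p = 0"
  using coeff_mul_monic_top[OF assms(1), of p] assms(2) by simp

text \<open>A nonzero \<open>p\<close> would put \<open>lead_coeff p\<close> at a degree no smaller
  than \<open>degree q\<close>. This is what makes representatives of degree below n unique modulo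
  Rf.\<close>

lemma mul_monic_degree_less:
  assumes "lead_coeff q = 1" and "degree (p \<star> q) < degree q"
  shows "p = 0"
  using coeff_mul_monic_top[OF assms(1), of p] assms(2) by (simp add: coeff_eq_0)

section \<open>Left ideals and residue classes modulo Rf\<close>

lemma left_ideal_add:
  assumes "p \<in> left_ideal \<sigma> \<delta> f" and "q \<in> left_ideal \<sigma> \<delta> f"
  shows "p + q \<in> left_ideal \<sigma> \<delta> f"
  using assms by (auto simp: left_ideal_def mul_add_left[symmetric])

lemma left_ideal_diff:
  assumes "p \<in> left_ideal \<sigma> \<delta> f" and "q \<in> left_ideal \<sigma> \<delta> f"
  shows "p - q \<in> left_ideal \<sigma> \<delta> f"
  using assms by (auto simp: left_ideal_def mul_diff_left[symmetric])

lemma left_ideal_0: "0 \<in> left_ideal \<sigma> \<delta> f"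
  unfolding left_ideal_def by (rule range_eqI[of _ _ 0]) (simp add: mul_zero_left)

lemma left_ideal_mul:
  assumes "p \<in> left_ideal \<sigma> \<delta> f"
  shows "r \<star> p \<in> left_ideal \<sigma> \<delta> f"
  using assms by (auto simp: left_ideal_def mul_assoc[symmetric])

lemma left_ideal_sum:
  assumes "\<And>i. i \<in> I \<Longrightarrow> u i \<in> left_ideal \<sigma> \<delta> f"
  shows "sum u I \<in> left_ideal \<sigma> \<delta> f"
  using assms
  by (induction I rule: infinite_finite_induct) (simp_all add: left_ideal_0 left_ideal_add)

lemma left_ideal_diff_iff:
  assumes "p - q \<in> left_ideal \<sigma> \<delta> f"
  shows "p \<in> left_ideal \<sigma> \<delta> f \<longleftrightarrow> q \<in> left_ideal \<sigma> \<delta> f"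
  using left_ideal_add[OF assms, of q] left_ideal_diff[OF _ assms, of p] by auto

text \<open>The passage between (i) and (ii): p h = r g h means (p - r g) h = 0, and the monic h
  cancels.\<close>

lemma left_ideal_mul_monic_iff:
  assumes "lead_coeff h = 1"
  shows "p \<star> h \<in> left_ideal \<sigma> \<delta> (g \<star> h) \<longleftrightarrow> p \<in> left_ideal \<sigma> \<delta> g"
proof
  assume "p \<star> h \<in> left_ideal \<sigma> \<delta> (g \<star> h)"
  then obtain r where "(p - r \<star> g) \<star> h = 0"
    by (auto simp: left_ideal_def mul_diff_left mul_assoc)
  from mul_monic_eq_0[OF assms this] show "p \<in> left_ideal \<sigma> \<delta> g"
    by (auto simp: left_ideal_def)
qed (auto simp: left_ideal_def mul_assoc)

text \<open>A class in Rg/Rf may be presented by a representative other than \<open>p\<close>. The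
  factorization f = h' g puts Rf inside Rg, so membership in Rg does not depend on the
  representative.\<close>

lemma class_in_quotient_submodule_iff:
  assumes "f = h' \<star> g"
  shows "cong_rel \<sigma> \<delta> f `` {p} \<in> quotient_submodule \<sigma> \<delta> g f \<longleftrightarrow> p \<in> left_ideal \<sigma> \<delta> g"
proof
  assume "cong_rel \<sigma> \<delta> f `` {p} \<in> quotient_submodule \<sigma> \<delta> g f"
  then obtain q where q: "q \<in> left_ideal \<sigma> \<delta> g" "cong_rel \<sigma> \<delta> f `` {p} = cong_rel \<sigma> \<delta> f `` {q}"
    by (auto simp: quotient_submodule_def elim!: quotientE)
  have "q \<in> cong_rel \<sigma> \<delta> f `` {q}"
    by (simp add: cong_rel_def left_ideal_0)
  then have "p - q \<in> left_ideal \<sigma> \<delta> f"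
    unfolding q(2)[symmetric] by (simp add: cong_rel_def)
  then have "p - q \<in> left_ideal \<sigma> \<delta> g"
    by (auto simp: assms left_ideal_def mul_assoc[symmetric])
  with q(1) show "p \<in> left_ideal \<sigma> \<delta> g"
    by (simp add: left_ideal_diff_iff)
qed (auto simp: quotient_submodule_def intro: quotientI)

section \<open>Coordinate vectors and their polynomials\<close>

lemma coeff_poly_of_coords: "coeff (poly_of_coords v) i = (if i < dim_vec v then v $ i else 0)"
  by (simp add: poly_of_coords_def coeff_sum)

lemma poly_of_coords_in_left_ideal_iff:
  assumes "lead_coeff f = 1" and "v \<in> carrier_vec (degree f)" and "degree f > 0"
  shows "poly_of_coords v \<in> left_ideal \<sigma> \<delta> f \<longleftrightarrow> v = 0\<^sub>v (degree f)"
proof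
  assume "poly_of_coords v \<in> left_ideal \<sigma> \<delta> f"
  then obtain r where r: "poly_of_coords v = r \<star> f"
    by (auto simp: left_ideal_def)
  \<comment> \<open>Strictness uses \<open>degree f > 0\<close>, since the zero polynomial has
    degree 0.\<close>
  have "degree (poly_of_coords v) < degree f"
    using assms(2,3) by (intro degree_lessI) (auto simp: coeff_poly_of_coords)
  then have "poly_of_coords v = 0"
    using mul_monic_degree_less[OF assms(1), of r] by (simp add: r mul_zero_left)
  then have "v $ i = 0" if "i < degree f" for i
    using coeff_poly_of_coords[of v i] assms(2) that by simp
  then show "v = 0\<^sub>v (degree f)"
    using assms(2) by (intro eq_vecI) auto
next
  assume "v = 0\<^sub>v (degree f)"
  then have "poly_of_coords v = 0"
    by (intro poly_eqI) (simp add: coeff_poly_of_coords)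
  then show "poly_of_coords v \<in> left_ideal \<sigma> \<delta> f"
    by (simp add: left_ideal_0)
qed

section \<open>The map T_f in coordinates\<close>

lemma row_mult_mat_index:
  assumes "M \<in> carrier_mat n n" and "v \<in> carrier_vec n" and "k < n"
  shows "(v \<^sub>v* M) $ k = (\<Sum>l<n. v $ l * M $$ (l, k))"
  using assms by (simp add: row_mult_mat_def scalar_prod_def atLeast0LessThan)

lemma companion_mat_carrier: "companion_mat f \<in> carrier_mat (degree f) (degree f)"
  by (simp add: companion_mat_def)

lemma T_map_carrier:
  assumes "x \<in> carrier_vec (degree f)"
  shows "T_map \<sigma> \<delta> f x \<in> carrier_vec (degree f)"
  using carrier_vecD[OF assms] by (intro carrier_vecI) (simp add: T_map_def)

lemma T_map_pow_carrier:
  assumes "x \<in> carrier_vec (degree f)"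
  shows "(T_map \<sigma> \<delta> f ^^ i) x \<in> carrier_vec (degree f)"
  using assms by (induction i) (simp_all add: T_map_carrier)

text \<open>This form keeps the entries of C_f symbolic, as the recursion for N_j needs; the next
  lemma evaluates them for comparison with \<open>T\<close>.\<close>

lemma T_map_index:
  assumes "x \<in> carrier_vec (degree f)" and "k < degree f"
  shows "T_map \<sigma> \<delta> f x $ k
    = (\<Sum>l<degree f. \<sigma> (x $ l) * companion_mat f $$ (l, k)) + \<delta> (x $ k)"
  using assms row_mult_mat_index[OF companion_mat_carrier, of "map_vec \<sigma> x" f k]
  by (simp add: T_map_def)

text \<open>Column k of C_f holds \<open>- coeff f k\<close> in the last row and, if k > 0, a 1 in
  row k - 1: a shift of the coordinates corrected by a multiple of f.\<close>

lemma T_map_index_companion: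
  assumes "x \<in> carrier_vec (degree f)" and "k < degree f"
  shows "T_map \<sigma> \<delta> f x $ k = (case k of 0 \<Rightarrow> 0 | Suc j \<Rightarrow> \<sigma> (x $ j)) + \<delta> (x $ k)
    - \<sigma> (x $ (degree f - 1)) * coeff f k"
proof -
  obtain m where m: "degree f = Suc m"
    using assms(2) by (cases "degree f") auto
  \<comment> \<open>Row \<open>m\<close> is the last one and is split off; the other rows hold only
    zeros and ones.\<close>
  have "(\<Sum>l<degree f. \<sigma> (x $ l) * companion_mat f $$ (l, k))
      = (\<Sum>l<m. if k = Suc l then \<sigma> (x $ l) else 0) - \<sigma> (x $ m) * coeff f k"
    using assms(2) by (simp add: m companion_mat_def) (intro sum.cong, auto)
  also have "(\<Sum>l<m. if k = Suc l then \<sigma> (x $ l) else 0)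
      = (case k of 0 \<Rightarrow> 0 | Suc j \<Rightarrow> \<sigma> (x $ j))"
    using assms(2) by (cases k) (simp_all add: m)
  finally show ?thesis
    by (simp add: T_map_index[OF assms] m)
qed

text \<open>Multiplication by t pushes \<sigma>(x_{n-1}) up to t^n. Subtracting that multiple of the
  monic f removes the overflow and leaves in the lower coordinates what the last row of C_f
  contributes.\<close>

lemma T_poly_of_coords:
  assumes "lead_coeff f = 1" and "x \<in> carrier_vec (degree f)" and "degree f > 0"
  shows "T (poly_of_coords x)
    = poly_of_coords (T_map \<sigma> \<delta> f x) + left_scale (\<sigma> (x $ (degree f - 1))) f"
proof (rule poly_eqI)
  fix k
  have dims: "dim_vec x = degree f" "dim_vec (T_map \<sigma> \<delta> f x) = degree f"
    using assms(2) T_map_carrier[OF assms(2)] by auto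
  consider "k < degree f" | "k = degree f" | "k > degree f" by linarith
  then show "coeff (T (poly_of_coords x)) k
    = coeff (poly_of_coords (T_map \<sigma> \<delta> f x) + left_scale (\<sigma> (x $ (degree f - 1))) f) k"
  proof cases
    case 1
    then show ?thesis
      by (simp add: coeff_T coeff_poly_of_coords dims T_map_index_companion[OF assms(2)]
          split: nat.split)
  next
    \<comment> \<open>At t^n the left side is \<sigma>(x_{n-1}), pushed up from below; on the right
      only f contributes, with coefficient 1.\<close>
    case 2
    obtain j where "degree f = Suc j"
      using assms(3) by (cases "degree f") auto
    with 2 have j: "k = Suc j" "j < degree f" "degree f - 1 = j"
      by simp_all
    have "coeff f k = 1"
      using assms(1) 2 by simp
    moreover have "\<not> k < degree f"
      using 2 by simp
    ultimately show ?thesis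
      unfolding j(3) using j(1,2) by (simp add: coeff_T coeff_poly_of_coords dims)
  next
    case 3
    then show ?thesis
      by (cases k) (simp_all add: coeff_T coeff_poly_of_coords dims coeff_eq_0)
  qed
qed

lemma T_pow_cong_T_map_pow:
  assumes "lead_coeff f = 1" and "x \<in> carrier_vec (degree f)" and "degree f > 0"
  shows "(T ^^ i) (poly_of_coords x) - poly_of_coords ((T_map \<sigma> \<delta> f ^^ i) x) \<in> left_ideal \<sigma> \<delta> f"
proof (induction i)
  case 0
  then show ?case by (simp add: left_ideal_0)
next
  case (Suc i)
  define y where "y = (T_map \<sigma> \<delta> f ^^ i) x"
  have y: "y \<in> carrier_vec (degree f)"
    unfolding y_def by (rule T_map_pow_carrier[OF assms(2)])
  \<comment> \<open>\<open>d\<close> is the error made so far. Multiplying it by t keeps it in the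
    left ideal Rf, and passing once more from \<open>T\<close> to T_f adds a multiple of f.\<close>
  define d where "d = (T ^^ i) (poly_of_coords x) - poly_of_coords y"
  have "(T ^^ Suc i) (poly_of_coords x) = T (d + poly_of_coords y)"
    by (simp add: d_def)
  also have "\<dots> = T d + T (poly_of_coords y)"
    by (simp add: T_conv_mul mul_add_right)
  finally have "(T ^^ Suc i) (poly_of_coords x) - poly_of_coords ((T_map \<sigma> \<delta> f ^^ Suc i) x)
      = T d + left_scale (\<sigma> (y $ (degree f - 1))) f"
    by (simp add: T_poly_of_coords[OF assms(1) y assms(3)] flip: y_def)
  moreover have "d \<in> left_ideal \<sigma> \<delta> f"
    using Suc.IH by (simp add: d_def y_def)
  then have "T d \<in> left_ideal \<sigma> \<delta> f"
    unfolding T_conv_mul by (rule left_ideal_mul)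
  moreover have "left_scale a f \<in> left_ideal \<sigma> \<delta> f" for a
    by (auto simp: left_ideal_def const_mul[symmetric])
  ultimately show ?case
    by (simp add: left_ideal_add)
qed

section \<open>Words in \<sigma> and \<delta>, and the expansion of the powers of T_f\<close>

lemma word_sum_eq_0:
  assumes "i < j"
  shows "word_sum \<sigma> \<delta> i j a = 0"
proof -
  have "{w. length w = i \<and> count_list w True = j} = {}"
    using assms count_le_length[of _ True] by (auto simp: leD)
  then show ?thesis by (simp only: word_sum_def sum.empty)
qed

lemma finite_words: "finite {w :: bool list. length w = i \<and> count_list w True = j}"
  by (rule finite_subset[OF _ finite_lists_length_eq[of UNIV i]]) auto

text \<open>Words are split by their first letter, the map that \<open>foldr\<close> applies last. A
  leading \<sigma> leaves one \<sigma> fewer, impossible for j = 0; additivity of \<sigma> and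
  \<delta> moves the letter out of the sum.\<close>

lemma word_sum_Suc:
  "word_sum \<sigma> \<delta> (Suc i) j a
    = (case j of 0 \<Rightarrow> 0 | Suc k \<Rightarrow> \<sigma> (word_sum \<sigma> \<delta> i k a)) + \<delta> (word_sum \<sigma> \<delta> i j a)"
proof -
  let ?W = "\<lambda>i j. {w. length w = i \<and> count_list w True = j}"
  let ?S = "case j of 0 \<Rightarrow> {} | Suc k \<Rightarrow> (#) True ` ?W i k"
  have split: "?W (Suc i) j = ?S \<union> (#) False ` ?W i j"
    by (auto simp: length_Suc_conv image_iff split: nat.split if_splits)
  have "word_sum \<sigma> \<delta> (Suc i) j a
      = (\<Sum>w\<in>?S. word_map \<sigma> \<delta> w a) + (\<Sum>w\<in>(#) False ` ?W i j. word_map \<sigma> \<delta> w a)"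
    unfolding word_sum_def split
    by (rule sum.union_disjoint) (auto simp: finite_words split: nat.split)
  also have "(\<Sum>w\<in>(#) False ` ?W i j. word_map \<sigma> \<delta> w a) = \<delta> (word_sum \<sigma> \<delta> i j a)"
    by (simp add: sum.reindex word_sum_def \<delta>_sum word_map_def)
  also have "(\<Sum>w\<in>?S. word_map \<sigma> \<delta> w a)
      = (case j of 0 \<Rightarrow> 0 | Suc k \<Rightarrow> \<sigma> (word_sum \<sigma> \<delta> i k a))"
    by (simp add: sum.reindex word_sum_def \<sigma>_sum word_map_def split: nat.split)
  finally show ?thesis .
qed

lemma N_mat_carrier:
  assumes "M \<in> carrier_mat n n"
  shows "N_mat \<sigma> \<delta> M j \<in> carrier_mat n n"
  using assms by (induction j) auto

lemma N_mat_Suc_index: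
  assumes "M \<in> carrier_mat n n" and "l < n" and "k < n"
  shows "N_mat \<sigma> \<delta> M (Suc j) $$ (l, k)
    = (\<Sum>r<n. \<sigma> (N_mat \<sigma> \<delta> M j $$ (l, r)) * M $$ (r, k)) + \<delta> (N_mat \<sigma> \<delta> M j $$ (l, k))"
  using assms N_mat_carrier[OF assms(1), of j]
  by (simp add: scalar_prod_def atLeast0LessThan)

text \<open>Any bound \<open>m > i\<close> on \<open>j\<close> is allowed, as \<open>f\<^sub>j\<^sup>i = 0\<close> for \<open>j > i\<close>.\<close>

lemma T_map_pow_index:
  assumes "x \<in> carrier_vec (degree f)" and "i < m" and "k < degree f"
  shows "(T_map \<sigma> \<delta> f ^^ i) x $ k
    = (\<Sum>j<m. \<Sum>l<degree f. word_sum \<sigma> \<delta> i j (x $ l) * N_mat \<sigma> \<delta> (companion_mat f) j $$ (l, k))"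
  using assms(2,3)
proof (induction i arbitrary: m k)
  case 0
  have ws0: "word_sum \<sigma> \<delta> 0 j a = (if j = 0 then a else 0)" for j a
  proof (cases "j = 0")
    case True
    have "{w :: bool list. w = [] \<and> count_list w True = 0} = {[]}" by auto
    with True show ?thesis by (simp add: word_sum_def word_map_def)
  qed (simp add: word_sum_eq_0)
  obtain m' where m: "m = Suc m'" using 0 by (cases m) auto
  have "(\<Sum>j<m. \<Sum>l<degree f. word_sum \<sigma> \<delta> 0 j (x $ l) * N_mat \<sigma> \<delta> (companion_mat f) j $$ (l, k))
    = (\<Sum>l<degree f. x $ l * N_mat \<sigma> \<delta> (companion_mat f) 0 $$ (l, k))"
    by (simp add: m sum.lessThan_Suc_shift ws0 del: sum.lessThan_Suc)
  also have "\<dots> = (\<Sum>l<degree f. if l = k then x $ l else 0)"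
    using 0 companion_mat_carrier[of f] by (intro sum.cong) auto
  finally show ?case using 0 by simp
next
  case (Suc i)
  let ?n = "degree f" and ?C = "companion_mat f"
  let ?N = "N_mat \<sigma> \<delta> ?C"
  let ?w = "\<lambda>j l. word_sum \<sigma> \<delta> i j (x $ l)"
  obtain m' where m: "m = Suc m'" and i: "i < m'" using Suc.prems by (cases m) auto
  \<comment> \<open>The same bound \<open>m\<close> serves for \<open>i\<close>, since it need only
    exceed it.\<close>
  have IH: "(T_map \<sigma> \<delta> f ^^ i) x $ r = (\<Sum>j<m. \<Sum>l<?n. ?w j l * ?N j $$ (l, r))" if "r < ?n" for r
    using Suc.IH[of m r] Suc.prems that by simp
  have "(T_map \<sigma> \<delta> f ^^ Suc i) x $ k
      = (\<Sum>r<?n. \<sigma> ((T_map \<sigma> \<delta> f ^^ i) x $ r) * ?C $$ (r, k)) + \<delta> ((T_map \<sigma> \<delta> f ^^ i) x $ k)"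
    using T_map_index[OF T_map_pow_carrier[OF assms(1)] Suc.prems(2)] by simp
  also have "(\<Sum>r<?n. \<sigma> ((T_map \<sigma> \<delta> f ^^ i) x $ r) * ?C $$ (r, k))
      = (\<Sum>r<?n. \<Sum>j<m. \<Sum>l<?n. \<sigma> (?w j l) * (\<sigma> (?N j $$ (l, r)) * ?C $$ (r, k)))"
    by (intro sum.cong refl) (simp add: IH \<sigma>_sum \<sigma>.hom_mult sum_distrib_right mult.assoc)
  \<comment> \<open>The index r of the product with C_f is moved innermost, where the sum over r
    becomes one part of N_{j+1}.\<close>
  also have "\<dots> = (\<Sum>j<m. \<Sum>r<?n. \<Sum>l<?n. \<sigma> (?w j l) * (\<sigma> (?N j $$ (l, r)) * ?C $$ (r, k)))"
    by (rule sum.swap)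
  also have "\<dots> = (\<Sum>j<m. \<Sum>l<?n. \<Sum>r<?n. \<sigma> (?w j l) * (\<sigma> (?N j $$ (l, r)) * ?C $$ (r, k)))"
    by (intro sum.cong refl sum.swap)
  \<comment> \<open>The twisted product rule yields \<sigma>(w) \<delta>(N_j), the part still
    missing from N_{j+1}, and \<delta>(w) N_j.\<close>
  also have "\<delta> ((T_map \<sigma> \<delta> f ^^ i) x $ k)
      = (\<Sum>j<m. \<Sum>l<?n. \<sigma> (?w j l) * \<delta> (?N j $$ (l, k)) + \<delta> (?w j l) * ?N j $$ (l, k))"
    by (simp add: IH Suc.prems \<delta>_sum \<delta>_mult)
  also have "(\<Sum>j<m. \<Sum>l<?n. \<Sum>r<?n. \<sigma> (?w j l) * (\<sigma> (?N j $$ (l, r)) * ?C $$ (r, k))) + \<dots>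
      = (\<Sum>j<m. \<Sum>l<?n. \<sigma> (?w j l) * ?N (Suc j) $$ (l, k))
        + (\<Sum>j<m. \<Sum>l<?n. \<delta> (?w j l) * ?N j $$ (l, k))"
    unfolding sum.distrib[symmetric]
    by (intro sum.cong refl)
       (simp add: N_mat_Suc_index[OF companion_mat_carrier] Suc.prems distrib_left sum_distrib_left
         add.assoc del: N_mat.simps)
  \<comment> \<open>The top term j = m' drops out, as no word of length i < m' has m' letters
    \<sigma>. This makes room for the shift from j to j + 1.\<close>
  also have "(\<Sum>j<m. \<Sum>l<?n. \<sigma> (?w j l) * ?N (Suc j) $$ (l, k))
      = (\<Sum>j<m'. \<Sum>l<?n. \<sigma> (?w j l) * ?N (Suc j) $$ (l, k))"
    by (simp add: m word_sum_eq_0[OF i] del: N_mat.simps)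
  \<comment> \<open>After the shift, index 0 receives the value 0, matching the case j = 0 of
    \<open>word_sum_Suc\<close>.\<close>
  also have "\<dots> = (\<Sum>j<m. \<Sum>l<?n. (case j of 0 \<Rightarrow> 0 | Suc j' \<Rightarrow> \<sigma> (?w j' l)) * ?N j $$ (l, k))"
    by (simp add: m sum.lessThan_Suc_shift del: sum.lessThan_Suc N_mat.simps)
  finally show ?case
    by (simp only: word_sum_Suc distrib_right sum.distrib)
qed

section \<open>Comparison of the conditions (ii), (iii) and (iv)\<close>

text \<open>(iii) and (iv) concern one and the same vector: expand each T_f^i with the common bound
  j < n and interchange the sums.\<close>

lemma sum_T_map_pow_eq:
  assumes "hv \<in> carrier_vec (degree f)" and "n = degree f"
  shows "finsum_vec TYPE('a) n (\<lambda>i. c $ i \<cdot>\<^sub>v (T_map \<sigma> \<delta> f ^^ i) hv) {0..<n}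
    = finsum_vec TYPE('a) n
        (\<lambda>j. finsum_vec TYPE('a) n (\<lambda>i. c $ i \<cdot>\<^sub>v map_vec (word_sum \<sigma> \<delta> i j) hv) {j..<n}
               \<^sub>v* N_mat \<sigma> \<delta> (companion_mat f) j) {0..<n}"
    (is "?L = finsum_vec _ _ (\<lambda>j. ?u j \<^sub>v* ?N j) _")
proof -
  have N: "?N j \<in> carrier_mat n n" for j
    using N_mat_carrier[OF companion_mat_carrier[of f]] assms(2) by simp
  have uN: "?u j \<^sub>v* ?N j \<in> carrier_vec n" for j
    using N[of j] by (simp add: row_mult_mat_def)
  have L: "c $ i \<cdot>\<^sub>v (T_map \<sigma> \<delta> f ^^ i) hv \<in> carrier_vec n" for i
    using T_map_pow_carrier[OF assms(1)] assms(2) by simp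
  have W: "c $ i \<cdot>\<^sub>v map_vec (word_sum \<sigma> \<delta> i j) hv \<in> carrier_vec n" for i j
    using assms by simp
  have u: "?u j \<in> carrier_vec n" for j
    using W by (intro finsum_vec_closed) auto
  have u_index: "?u j $ l = (\<Sum>i<n. c $ i * word_sum \<sigma> \<delta> i j (hv $ l))" if "l < n" for j l
  proof -
    have "?u j $ l = (\<Sum>i\<in>{j..<n}. c $ i * word_sum \<sigma> \<delta> i j (hv $ l))"
      using W that assms by (subst index_finsum_vec) auto
    \<comment> \<open>Terms with i < j vanish, so the range of i becomes independent of j and the
      sums can be interchanged.\<close>
    also have "\<dots> = (\<Sum>i<n. c $ i * word_sum \<sigma> \<delta> i j (hv $ l))"
      by (rule sum.mono_neutral_left) (auto simp: word_sum_eq_0)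
    finally show ?thesis .
  qed
  show ?thesis
  proof (rule eq_vecI)
    show "dim_vec ?L = dim_vec (finsum_vec TYPE('a) n (\<lambda>j. ?u j \<^sub>v* ?N j) {0..<n})"
      using finsum_vec_closed[of "\<lambda>i. c $ i \<cdot>\<^sub>v (T_map \<sigma> \<delta> f ^^ i) hv" "{0..<n}" n]
        finsum_vec_closed[of "\<lambda>j. ?u j \<^sub>v* ?N j" "{0..<n}" n] L uN by auto
    fix k assume "k < dim_vec (finsum_vec TYPE('a) n (\<lambda>j. ?u j \<^sub>v* ?N j) {0..<n})"
    then have k: "k < n"
      using finsum_vec_closed[of "\<lambda>j. ?u j \<^sub>v* ?N j" "{0..<n}" n] uN by auto
    have "?L $ k = (\<Sum>i<n. c $ i * (T_map \<sigma> \<delta> f ^^ i) hv $ k)"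
      using L k T_map_pow_carrier[OF assms(1)] assms(2)
      by (subst index_finsum_vec)
         (auto simp: atLeast0LessThan carrier_vecD[OF T_map_pow_carrier[OF assms(1)]])
    also have "\<dots> = (\<Sum>i<n. \<Sum>j<n. \<Sum>l<n. c $ i * word_sum \<sigma> \<delta> i j (hv $ l) * ?N j $$ (l, k))"
      using k by (intro sum.cong refl)
        (simp add: T_map_pow_index[OF assms(1), where m = n] assms(2) sum_distrib_left mult.assoc)
    also have "\<dots> = (\<Sum>j<n. \<Sum>i<n. \<Sum>l<n. c $ i * word_sum \<sigma> \<delta> i j (hv $ l) * ?N j $$ (l, k))"
      by (rule sum.swap)
    also have "\<dots> = (\<Sum>j<n. \<Sum>l<n. \<Sum>i<n. c $ i * word_sum \<sigma> \<delta> i j (hv $ l) * ?N j $$ (l, k))"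
      by (intro sum.cong refl sum.swap)
    also have "\<dots> = (\<Sum>j<n. (?u j \<^sub>v* ?N j) $ k)"
      by (simp add: row_mult_mat_index[OF N u k] u_index sum_distrib_right)
    also have "\<dots> = finsum_vec TYPE('a) n (\<lambda>j. ?u j \<^sub>v* ?N j) {0..<n} $ k"
      using uN k by (subst index_finsum_vec) (auto simp: atLeast0LessThan)
    finally show "?L $ k = finsum_vec TYPE('a) n (\<lambda>j. ?u j \<^sub>v* ?N j) {0..<n} $ k" .
  qed
qed

text \<open>This joins (ii) and (iii). The product and the polynomial with coordinates
  \<open>?v\<close> differ by the combination, with left coefficients c_i, of the errors between
  \<open>T ^^ i\<close> and T_f^i; each error lies in Rf, and Rf is closed under left
  multiplication.\<close>

lemma mul_in_left_ideal_iff_sum_T_map_pow: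
  assumes "lead_coeff f = 1" and "hv \<in> carrier_vec (degree f)" and "degree f > 0" and "n = degree f"
  shows "(\<Sum>i<n. monom (c $ i) i) \<star> poly_of_coords hv \<in> left_ideal \<sigma> \<delta> f \<longleftrightarrow>
    finsum_vec TYPE('a) n (\<lambda>i. c $ i \<cdot>\<^sub>v (T_map \<sigma> \<delta> f ^^ i) hv) {0..<n} = 0\<^sub>v n"
    (is "?p \<in> _ \<longleftrightarrow> ?v = _")
proof -
  let ?y = "\<lambda>i. (T_map \<sigma> \<delta> f ^^ i) hv"
  have y: "?y i \<in> carrier_vec n" for i
    using T_map_pow_carrier[OF assms(2)] assms(4) by simp
  have v: "?v \<in> carrier_vec n"
    using y by (intro finsum_vec_closed) auto
  have v_index: "?v $ k = (\<Sum>i<n. c $ i * ?y i $ k)" if "k < n" for k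
    using y that by (subst index_finsum_vec) (auto simp: atLeast0LessThan carrier_vecD[OF y])
  have "poly_of_coords ?v = (\<Sum>i<n. left_scale (c $ i) (poly_of_coords (?y i)))"
    using v y
    by (intro poly_eqI)
       (auto simp: coeff_sum coeff_poly_of_coords v_index carrier_vecD[OF v] carrier_vecD[OF y])
  then have "?p - poly_of_coords ?v
      = (\<Sum>i<n. [:c $ i:] \<star> ((T ^^ i) (poly_of_coords hv) - poly_of_coords (?y i)))"
    by (intro poly_eqI)
       (simp add: mul_sum_left monom_mul const_mul coeff_sum sum_subtractf algebra_simps)
  then have "?p - poly_of_coords ?v \<in> left_ideal \<sigma> \<delta> f"
    by (simp add: left_ideal_sum left_ideal_mul T_pow_cong_T_map_pow[OF assms(1-3)])
  then have "?p \<in> left_ideal \<sigma> \<delta> f \<longleftrightarrow> poly_of_coords ?v \<in> left_ideal \<sigma> \<delta> f"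
    by (rule left_ideal_diff_iff)
  also have "\<dots> \<longleftrightarrow> ?v = 0\<^sub>v n"
    using poly_of_coords_in_left_ideal_iff[OF assms(1) _ assms(3), of ?v] v assms(4) by simp
  finally show ?thesis .
qed

end

theorem theorem3p6:
  fixes \<sigma> \<delta> :: "'a::ring_1 \<Rightarrow> 'a"
    and f g h h' :: "'a poly"
    and n :: nat
    and c hv :: "'a vec"
  assumes "Ring_Hom.ring_hom \<sigma>"
    and "skew_derivation \<sigma> \<delta>"
    and "lead_coeff f = 1" and "lead_coeff g = 1" and "lead_coeff h = 1" and "lead_coeff h' = 1"
    and "f = skew_mult \<sigma> \<delta> g h"
    and "f = skew_mult \<sigma> \<delta> h' g"
    and "degree f = n" and "n > 0" and "degree h < n"
    and "hv = vec n (coeff h)"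
    and "c \<in> carrier_vec n"
  shows "(c \<in> code \<sigma> \<delta> g f \<longleftrightarrow>
            skew_mult \<sigma> \<delta> (\<Sum>i<n. monom (c $ i) i) h \<in> left_ideal \<sigma> \<delta> f) \<and>
         (skew_mult \<sigma> \<delta> (\<Sum>i<n. monom (c $ i) i) h \<in> left_ideal \<sigma> \<delta> f \<longleftrightarrow>
            finsum_vec TYPE('a) n (\<lambda>i. c $ i \<cdot>\<^sub>v (T_map \<sigma> \<delta> f ^^ i) hv) {0..<n} = 0\<^sub>v n) \<and>
         (finsum_vec TYPE('a) n (\<lambda>i. c $ i \<cdot>\<^sub>v (T_map \<sigma> \<delta> f ^^ i) hv) {0..<n} = 0\<^sub>v n \<longleftrightarrow>
            finsum_vec TYPE('a) n
              (\<lambda>j. finsum_vec TYPE('a) n (\<lambda>i. c $ i \<cdot>\<^sub>v map_vec (word_sum \<sigma> \<delta> i j) hv) {j..<n}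
                     \<^sub>v* N_mat \<sigma> \<delta> (companion_mat f) j) {0..<n} = 0\<^sub>v n)"
proof -
  interpret skew_poly \<sigma> \<delta>
    using assms(1,2) by (rule skew_poly.intro)
  have hv: "hv \<in> carrier_vec (degree f)"
    using assms(9,12) by simp
  \<comment> \<open>No coefficient is cut off, because \<open>degree h < n\<close>.\<close>
  have h: "poly_of_coords hv = h"
    using assms(11,12) by (intro poly_eqI) (simp add: coeff_poly_of_coords coeff_eq_0)
  have c: "poly_of_coords c = (\<Sum>i<n. monom (c $ i) i)"
    using assms(13) by (simp add: poly_of_coords_def)
  \<comment> \<open>Here f = h' g reduces the code to membership in Rg; in the next step f = g h
    turns that into (ii).\<close>
  have "c \<in> code \<sigma> \<delta> g f \<longleftrightarrow> poly_of_coords c \<in> left_ideal \<sigma> \<delta> g"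
    using assms(9,13) class_in_quotient_submodule_iff[OF assms(8)] by (simp add: code_def)
  also have "\<dots> \<longleftrightarrow> skew_mult \<sigma> \<delta> (poly_of_coords c) h \<in> left_ideal \<sigma> \<delta> f"
    using left_ideal_mul_monic_iff[OF assms(5)] assms(7) by simp
  finally show ?thesis
    using mul_in_left_ideal_iff_sum_T_map_pow[OF assms(3) hv _ assms(9)[symmetric], of c]
      sum_T_map_pow_eq[OF hv assms(9)[symmetric], of c] assms(9,10)
    by (simp add: c h)
qed

end
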